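(* Let $k\ge 1$. For all $\Upsilon\subseteq\mathcal{F}_{2,k}$, $$N^{\Upsilon}(x,t)=\frac{A^{\Upsilon}(t)}{1-x\left(1+\left(\frac{t}{k!}-1\right)A^{\Upsilon}(t)\right)},$$ where $$N^{\Upsilon}(x,t)=1+\sum_{n\ge 1}\frac{t^n}{(kn)!}\sum_{F\in\mathcal{F}_{n,k}}x^{\Upsilon\text{-nlap}(F)},\qquad A^{\Upsilon}(t)=1+\sum_{n\ge 1}\frac{A^{\Upsilon}_{n,k}t^n}{(kn)!}.$$
   Context: $\mathcal{F}_{n,k}$ is the set of all fillings $F$ of the $k\times n$ rectangular array ($k$ rows, $n$ columns) with the integers $1,\dots,kn$, each used once, such that the elements in each column increase from bottom to top. For a filling of a $k\times n$ array by distinct positive integers with columns increasing from bottom to top, $\mathrm{red}(F)\in\mathcal{F}_{n,k}$ is obtained by replacing the $i$-th smallest entry by $i$. $F[c_1,\dots,c_j]$ is the filling of the $k\times j$ array whose $a$-th column is column $c_a$ of $F$. For $\Upsilon\subseteq\mathcal{F}_{2,k}$, $F\in\mathcal{F}_{n,k}$ has an $\Upsilon$-match starting at position $i$ ($1\le i\le n-1$) if $\mathrm{red}(F[i,i+1])\in\Upsilon$. Two $\Upsilon$-matches overlap if they share a common column; $\Upsilon\text{-nlap}(F)$ is the maximum number of (pairwise) nonoverlapping $\Upsilon$-matches in $F$. $A^{\Upsilon}_{n,k}$ is the number of $F\in\mathcal{F}_{n,k}$ that have no $\Upsilon$-matches. The identity is one of formal power series in $t$ with coefficients in $\mathbb{Q}[x]$.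 *)

theory Defs
  imports
    "HOL-Library.FuncSet"
    "HOL-Computational_Algebra.Polynomial"
    "HOL-Computational_Algebra.Formal_Power_Series"
begin

text \<open>
  An array with \<open>k\<close> rows and \<open>n\<close> columns is a function on cells \<open>(row, column)\<close>.  Rows are
  numbered from bottom to top, columns from left to right, both starting at 1.  Arrays are
  \<open>extensional\<close> on their cells, so that each one is represented by exactly one function.
\<close>

type_synonym filling = "nat \<times> nat \<Rightarrow> nat"

definition cells :: "nat \<Rightarrow> nat \<Rightarrow> (nat \<times> nat) set" where
  "cells n k = {1..k} \<times> {1..n}"

definition fillings :: "nat \<Rightarrow> nat \<Rightarrow> filling set" where
  "fillings n k =
     {F \<in> extensional (cells n k).
        bij_betw F (cells n k) {1..k * n} \<and>
        (\<forall>c\<in>{1..n}. strict_mono_on {1..k} (\<lambda>r. F (r, c)))}"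

text \<open>The \<open>i\<close>-th smallest entry is the one that is at least as large as exactly \<open>i\<close> entries.\<close>

definition red :: "nat \<Rightarrow> nat \<Rightarrow> filling \<Rightarrow> filling" where
  "red n k F = restrict (\<lambda>p. card {v \<in> F ` cells n k. v \<le> F p}) (cells n k)"

definition select_columns :: "nat \<Rightarrow> filling \<Rightarrow> nat list \<Rightarrow> filling" where
  "select_columns k F cs = restrict (\<lambda>(r, a). F (r, cs ! (a - 1))) (cells (length cs) k)"

definition matches :: "filling set \<Rightarrow> nat \<Rightarrow> nat \<Rightarrow> filling \<Rightarrow> nat set" where
  "matches \<Upsilon> n k F = {i \<in> {1..n - 1}. red 2 k (select_columns k F [i, i + 1]) \<in> \<Upsilon>}"

text \<open>A match is identified with its starting position \<open>i\<close>; it occupies columns \<open>i\<close> and \<open>i + 1\<close>.\<close>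

definition overlap :: "nat \<Rightarrow> nat \<Rightarrow> bool" where
  "overlap i j \<longleftrightarrow> {i, i + 1} \<inter> {j, j + 1} \<noteq> {}"

definition nlap :: "filling set \<Rightarrow> nat \<Rightarrow> nat \<Rightarrow> filling \<Rightarrow> nat" where
  "nlap \<Upsilon> n k F =
     Max {card M | M. M \<subseteq> matches \<Upsilon> n k F \<and> pairwise (\<lambda>i j. \<not> overlap i j) M}"

definition match_free_count :: "filling set \<Rightarrow> nat \<Rightarrow> nat \<Rightarrow> nat" where
  "match_free_count \<Upsilon> n k = card {F \<in> fillings n k. matches \<Upsilon> n k F = {}}"

text \<open>
  Power series in \<open>t\<close> (\<open>fps_X\<close>) over \<open>\<rat>[x]\<close>, where \<open>x\<close> is the polynomial \<open>[:0, 1:]\<close>.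
\<close>

definition N_series :: "filling set \<Rightarrow> nat \<Rightarrow> rat poly fps" where
  "N_series \<Upsilon> k =
     Abs_fps (\<lambda>n. if n = 0 then 1
       else smult (1 / fact (k * n)) (\<Sum>F\<in>fillings n k. [:0, 1:] ^ nlap \<Upsilon> n k F))"

definition A_series :: "filling set \<Rightarrow> nat \<Rightarrow> rat poly fps" where
  "A_series \<Upsilon> k =
     Abs_fps (\<lambda>n. if n = 0 then 1 else [:of_nat (match_free_count \<Upsilon> n k) / fact (k * n):])"

text \<open>
  The type \<open>rat poly\<close> has no \<open>inverse\<close> operation, so \<open>/\<close> is not available on \<open>rat poly fps\<close>.
  Division by a series with constant term 1 is multiplication by its (unique) inverse.
\<close>

definition fps_quot :: "'a::comm_ring_1 fps \<Rightarrow> 'a fps \<Rightarrow> 'a fps" where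
  "fps_quot f g = f * fps_right_inverse g 1"

lemma fps_quot_unique:
  fixes f g h :: "'a::comm_ring_1 fps"
  assumes "fps_nth g 0 = 1"
  shows "h = fps_quot f g \<longleftrightarrow> h * g = f"
proof -
  have inv: "g * fps_right_inverse g 1 = 1"
    using assms by (intro fps_right_inverse) simp
  show ?thesis
  proof
    assume "h = fps_quot f g"
    then have "h * g = f * (g * fps_right_inverse g 1)"
      by (simp add: fps_quot_def mult_ac)
    with inv show "h * g = f" by simp
  next
    assume "h * g = f"
    then have "fps_quot f g = h * (g * fps_right_inverse g 1)"
      unfolding fps_quot_def by (simp flip: mult.assoc)
    with inv show "h = fps_quot f g" by simp
  qed
qed

lemma denominator_nth_0:
  "fps_nth (1 - fps_const [:0, 1:] *
     (1 + (fps_const [:1 / fact k:] * fps_X - 1) * A_series \<Upsilon> k)) 0 = 1"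
  by (simp add: A_series_def)

lemma finite_fillings: "finite (fillings n k)"
proof -
  have "fillings n k \<subseteq> PiE (cells n k) (\<lambda>_. {1..k * n})"
    by (auto simp: fillings_def PiE_def dest: bij_betwE)
  moreover have "finite (PiE (cells n k) (\<lambda>_. {1..k * n}))"
    by (intro finite_PiE) (auto simp: cells_def)
  ultimately show ?thesis by (rule finite_subset)
qed

text \<open>The maximum in \<open>nlap\<close> is taken over a finite nonempty set.\<close>

lemma nlap_set:
  fixes \<Upsilon> n k F
  defines "S \<equiv> {card M | M. M \<subseteq> matches \<Upsilon> n k F \<and> pairwise (\<lambda>i j. \<not> overlap i j) M}"
  shows "finite S" "S \<noteq> {}"
proof -
  have "finite (matches \<Upsilon> n k F)" by (simp add: matches_def)
  then have "finite (card ` Pow (matches \<Upsilon> n k F))" by simp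
  then show "finite S" by (rule rev_finite_subset) (auto simp: S_def)
  have "card {} \<in> S" unfolding S_def by (auto intro!: exI[of _ "{}"])
  then show "S \<noteq> {}" by blast
qed

end

theory Submission
  imports Defs "HOL-Library.Infinite_Set"
begin

text \<open>
  Call the number of fillings with \<open>n\<close> columns and no match \<open>a n\<close>, and the number of those whose
  only match starts at position \<open>n - 1\<close>, that is, occupies the last two columns, \<open>b n\<close>.  Let \<open>A\<close>
  and \<open>B\<close> be the generating functions of \<open>a\<close> and \<open>b\<close>, with weights \<open>t ^ n / (k * n)!\<close>.

  A maximum set of nonoverlapping matches can be chosen greedily from the left.  So if the first
  match of \<open>F\<close> ends in column \<open>j\<close>, then \<open>nlap F\<close> is one more than \<open>nlap\<close> of the part of \<open>F\<close> to the
  right of column \<open>j\<close> (\<open>max_nonoverlapping_Min\<close>), while the first \<open>j\<close> columns form a filling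
  counted by \<open>b j\<close>.  A filling with \<open>j + m\<close> columns amounts to the choice of the \<open>k * j\<close> entries of
  its first \<open>j\<close> columns and of two independent fillings with \<open>j\<close> and with \<open>m\<close> columns
  (\<open>sum_fillings_split\<close>), so products of generating functions with the above weights describe
  juxtaposition.  Hence \<open>N = A + x * B * N\<close>.

  If one appends an arbitrary column to a match-free filling, the result is either match-free or
  its only match is at the end.  Hence \<open>t / k! * A = (A - 1) + B\<close>, and eliminating \<open>B\<close> gives the
  theorem.
\<close>

section \<open>Fillings with prescribed entries\<close>

text \<open>Column-increasing fillings whose set of entries is an arbitrary set \<open>V\<close>.\<close>

definition fillings_on :: "nat \<Rightarrow> nat \<Rightarrow> nat set \<Rightarrow> filling set" where
  "fillings_on n k V =
     {F \<in> extensional (cells n k).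
        bij_betw F (cells n k) V \<and>
        (\<forall>c\<in>{1..n}. strict_mono_on {1..k} (\<lambda>r. F (r, c)))}"

lemma fillings_eq: "fillings n k = fillings_on n k {1..k * n}"
  by (simp add: fillings_def fillings_on_def)

lemma mem_cells: "(r, c) \<in> cells n k \<longleftrightarrow> 1 \<le> r \<and> r \<le> k \<and> 1 \<le> c \<and> c \<le> n"
  by (auto simp: cells_def)

lemma card_cells: "card (cells n k) = k * n" and finite_cells: "finite (cells n k)"
  by (auto simp: cells_def)

lemma fillings_onD:
  assumes "F \<in> fillings_on n k V"
  shows "inj_on F (cells n k)" "F ` cells n k = V" "F \<in> extensional (cells n k)"
  using assms by (auto simp: fillings_on_def bij_betw_def)

lemma fillings_onI:
  assumes "F \<in> extensional (cells n k)" "inj_on F (cells n k)" "F ` cells n k = V"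
    and "\<And>r s c. \<lbrakk>1 \<le> r; r < s; s \<le> k; 1 \<le> c; c \<le> n\<rbrakk> \<Longrightarrow> F (r, c) < F (s, c)"
  shows "F \<in> fillings_on n k V"
  using assms unfolding fillings_on_def bij_betw_def by (auto intro!: strict_mono_onI)

lemma fillings_on_less:
  assumes "F \<in> fillings_on n k V" "1 \<le> r" "r < s" "s \<le> k" "1 \<le> c" "c \<le> n"
  shows "F (r, c) < F (s, c)"
  using assms unfolding fillings_on_def by (auto simp: strict_mono_on_def)

text \<open>Two arrays whose entries in the cells \<open>C\<close> are in the same relative order.\<close>

definition same_order :: "(nat \<times> nat) set \<Rightarrow> filling \<Rightarrow> filling \<Rightarrow> bool" where
  "same_order C F G \<longleftrightarrow> (\<forall>p\<in>C. \<forall>q\<in>C. F p \<le> F q \<longleftrightarrow> G p \<le> G q)"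

lemma same_order_inj_on:
  assumes "same_order C F G" "inj_on F C"
  shows "inj_on G C"
  using assms unfolding same_order_def inj_on_def by (metis order_antisym order_refl)

lemma red_cong:
  assumes so: "same_order (cells n k) F G" and inj: "inj_on F (cells n k)"
  shows "red n k F = red n k G"
proof -
  let ?C = "cells n k"
  have *: "card {v \<in> H ` ?C. v \<le> H p} = card {q \<in> ?C. H q \<le> H p}"
    if "inj_on H ?C" for H :: filling and p
  proof -
    have "{v \<in> H ` ?C. v \<le> H p} = H ` {q \<in> ?C. H q \<le> H p}" by auto
    moreover have "inj_on H {q \<in> ?C. H q \<le> H p}"
      using that by (rule inj_on_subset) auto
    ultimately show ?thesis by (simp add: card_image)
  qed
  have "{q \<in> ?C. F q \<le> F p} = {q \<in> ?C. G q \<le> G p}" if "p \<in> ?C" for p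
    using so that by (auto simp: same_order_def)
  then show ?thesis
    unfolding red_def using *[OF inj] *[OF same_order_inj_on[OF so inj]]
    by (intro ext) (auto simp: restrict_def)
qed

lemma red_filling:
  assumes "F \<in> fillings n k"
  shows "red n k F = F"
proof
  fix p
  have F: "F ` cells n k = {1..k * n}" "F \<in> extensional (cells n k)"
    using assms by (auto simp: fillings_eq dest: fillings_onD)
  show "red n k F p = F p"
  proof (cases "p \<in> cells n k")
    case True
    then have "F p \<in> {1..k * n}" using F by blast
    then have "{v \<in> {1..k * n}. v \<le> F p} = {1..F p}" by auto
    with True F show ?thesis by (simp add: red_def)
  next
    case False
    then show ?thesis using extensional_arb[OF F(2)] by (simp add: red_def)
  qed
qed

section \<open>Windows of consecutive columns\<close>

text \<open>The columns \<open>a + 1, \<dots>, a + m\<close> of an array.\<close>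

definition window :: "nat \<Rightarrow> nat \<Rightarrow> nat \<Rightarrow> filling \<Rightarrow> filling" where
  "window a m k F = restrict (\<lambda>(r, c). F (r, c + a)) (cells m k)"

lemma window_nth: "(r, c) \<in> cells m k \<Longrightarrow> window a m k F (r, c) = F (r, c + a)"
  by (simp add: window_def)

lemma window_extensional: "window a m k F \<in> extensional (cells m k)"
  by (simp add: window_def)

lemma inj_on_window:
  assumes "inj_on F (cells n k)" "a + m \<le> n"
  shows "inj_on (window a m k F) (cells m k)"
proof (rule inj_onI)
  fix p q assume pq: "p \<in> cells m k" "q \<in> cells m k" and eq: "window a m k F p = window a m k F q"
  obtain r c s d where [simp]: "p = (r, c)" "q = (s, d)" by (cases p, cases q)
  have "F (r, c + a) = F (s, d + a)" using eq pq by (simp add: window_nth)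
  then have "(r, c + a) = (s, d + a)"
    by (rule inj_onD[OF assms(1)]) (use pq assms(2) in \<open>auto simp: mem_cells\<close>)
  then show "p = q" by simp
qed

text \<open>
  The matches of a window are those of the whole array that lie inside it.  The entries of the
  window may be replaced by others in the same relative order.
\<close>

lemma mem_matches_window:
  assumes so: "same_order (cells m k) (window a m k F) G"
    and inj: "inj_on F (cells n k)" and le: "a + m \<le> n"
  shows "i \<in> matches \<Upsilon> m k G \<longleftrightarrow> i \<in> {1..m - 1} \<and> i + a \<in> matches \<Upsilon> n k F"
proof (cases "i \<in> {1..m - 1}")
  case True
  let ?f = "select_columns k F [i + a, i + a + 1]" and ?g = "select_columns k G [i, i + 1]"
  have f: "?f (r, c) = F (r, c - 1 + i + a)" and g: "?g (r, c) = G (r, c - 1 + i)"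
    and w: "window a m k F (r, c - 1 + i) = F (r, c - 1 + i + a)"
    if "(r, c) \<in> cells 2 k" for r c
  proof -
    have "c = 1 \<or> c = 2" "1 \<le> r" "r \<le> k" using that by (auto simp: mem_cells)
    then show "?f (r, c) = F (r, c - 1 + i + a)" "?g (r, c) = G (r, c - 1 + i)"
      "window a m k F (r, c - 1 + i) = F (r, c - 1 + i + a)"
      using True by (auto simp: select_columns_def mem_cells window_def)
  qed
  have cell: "(r, c - 1 + i) \<in> cells m k" "(r, c - 1 + i + a) \<in> cells n k"
    if "(r, c) \<in> cells 2 k" for r c
    using that True le by (auto simp: mem_cells)
  have "same_order (cells 2 k) ?f ?g"
    unfolding same_order_def
  proof (intro ballI)
    fix p q assume pq: "p \<in> cells 2 k" "q \<in> cells 2 k"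
    obtain r c s d where [simp]: "p = (r, c)" "q = (s, d)" by (cases p, cases q)
    have "window a m k F (r, c - 1 + i) \<le> window a m k F (s, d - 1 + i) \<longleftrightarrow>
        G (r, c - 1 + i) \<le> G (s, d - 1 + i)"
      using so cell(1)[of r c] cell(1)[of s d] pq unfolding same_order_def by auto
    then show "?f p \<le> ?f q \<longleftrightarrow> ?g p \<le> ?g q"
      using f[of r c] f[of s d] g[of r c] g[of s d] w[of r c] w[of s d] pq
      by (simp del: One_nat_def)
  qed
  moreover have "inj_on ?f (cells 2 k)"
  proof (rule inj_onI)
    fix p q assume pq: "p \<in> cells 2 k" "q \<in> cells 2 k" and eq: "?f p = ?f q"
    obtain r c s d where [simp]: "p = (r, c)" "q = (s, d)" by (cases p, cases q)
    have "F (r, c - 1 + i + a) = F (s, d - 1 + i + a)" 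
      using eq pq f[of r c] f[of s d] by (simp del: One_nat_def)
    then have "(r, c - 1 + i + a) = (s, d - 1 + i + a)"
      by (rule inj_onD[OF inj]) (use cell(2) pq in auto)
    then show "p = q" using pq by (auto simp: mem_cells)
  qed
  ultimately have "red 2 k ?f = red 2 k ?g" by (rule red_cong)
  then show ?thesis using True le by (auto simp: matches_def)
next
  case False
  then show ?thesis by (auto simp: matches_def)
qed

lemma same_order_refl: "same_order C F F"
  by (simp add: same_order_def)

lemmas mem_matches_window' = mem_matches_window[OF same_order_refl]

lemma matches_cong:
  assumes "same_order (cells n k) F G" "inj_on F (cells n k)"
  shows "matches \<Upsilon> n k F = matches \<Upsilon> n k G"
proof -
  have "same_order (cells n k) (window 0 n k F) G"
    using assms(1) by (auto simp: same_order_def window_nth)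
  from mem_matches_window[OF this assms(2)] show ?thesis
    by (auto simp: matches_def)
qed

text \<open>
  The array with \<open>j + m\<close> columns that consists of the \<open>j\<close> columns of \<open>G\<close> followed by the \<open>m\<close>
  columns of \<open>H\<close>.
\<close>

definition juxtapose :: "nat \<Rightarrow> nat \<Rightarrow> nat \<Rightarrow> filling \<Rightarrow> filling \<Rightarrow> filling" where
  "juxtapose j m k G H =
     restrict (\<lambda>(r, c). if c \<le> j then G (r, c) else H (r, c - j)) (cells (j + m) k)"

lemma window_juxtapose:
  assumes "G \<in> extensional (cells j k)" "H \<in> extensional (cells m k)"
  shows "window 0 j k (juxtapose j m k G H) = G" "window j m k (juxtapose j m k G H) = H"
proof -
  show "window 0 j k (juxtapose j m k G H) = G"
    using assms by (intro extensionalityI[OF window_extensional])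
      (auto simp: window_def juxtapose_def mem_cells)
  show "window j m k (juxtapose j m k G H) = H"
    using assms by (intro extensionalityI[OF window_extensional])
      (auto simp: window_def juxtapose_def mem_cells)
qed

lemma juxtapose_window:
  assumes "F \<in> extensional (cells (j + m) k)"
  shows "juxtapose j m k (window 0 j k F) (window j m k F) = F"
  by (rule extensionalityI[OF _ assms])
    (auto simp: window_def juxtapose_def mem_cells)

lemma cells_add:
  "cells (j + m) k = cells j k \<union> (\<lambda>(r, c). (r, c + j)) ` cells m k"
  "cells j k \<inter> (\<lambda>(r, c). (r, c + j)) ` cells m k = {}"
proof -
  have "(r, c) \<in> (\<lambda>(r, c). (r, c + j)) ` cells m k" if "(r, c) \<in> cells (j + m) k" "\<not> c \<le> j" for r c
    using that by (intro image_eqI[of _ _ "(r, c - j)"]) (auto simp: mem_cells)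
  moreover have "(r, c) \<in> cells j k" if "(r, c) \<in> cells (j + m) k" "c \<le> j" for r c
    using that by (auto simp: mem_cells)
  ultimately have "cells (j + m) k \<subseteq> cells j k \<union> (\<lambda>(r, c). (r, c + j)) ` cells m k" by auto
  moreover have "cells j k \<union> (\<lambda>(r, c). (r, c + j)) ` cells m k \<subseteq> cells (j + m) k"
    by (auto simp: mem_cells)
  ultimately show "cells (j + m) k = cells j k \<union> (\<lambda>(r, c). (r, c + j)) ` cells m k"
    by (rule equalityI)
  show "cells j k \<inter> (\<lambda>(r, c). (r, c + j)) ` cells m k = {}"
    by (auto simp: mem_cells)
qed

lemma window_in_fillings_on:
  assumes F: "F \<in> fillings_on (j + m) k V"
  shows "window 0 j k F \<in> fillings_on j k (F ` cells j k)"
    and "window j m k F \<in> fillings_on m k (V - F ` cells j k)"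
proof -
  note inj = fillings_onD(1)[OF F] and im = fillings_onD(2)[OF F]
  show "window 0 j k F \<in> fillings_on j k (F ` cells j k)"
  proof (rule fillings_onI)
    show "window 0 j k F ` cells j k = F ` cells j k"
      by (rule image_cong) (auto simp: window_nth)
  qed (use inj F in \<open>auto simp: window_extensional window_nth mem_cells
        intro: inj_on_window fillings_on_less\<close>)
  show "window j m k F \<in> fillings_on m k (V - F ` cells j k)"
  proof (rule fillings_onI)
    have "window j m k F ` cells m k = F ` (\<lambda>(r, c). (r, c + j)) ` cells m k"
      unfolding image_image by (rule image_cong) (auto simp: window_nth)
    also have "\<dots> = F ` (cells (j + m) k - cells j k)"
      unfolding cells_add(1) using cells_add(2)[of j k m] by (simp add: Un_Diff Diff_triv Int_commute)
    also have "\<dots> = F ` cells (j + m) k - F ` cells j k"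
      using inj by (rule inj_on_image_set_diff) (auto simp: mem_cells)
    finally show "window j m k F ` cells m k = V - F ` cells j k" by (simp add: im)
  qed (use inj F in \<open>auto simp: window_extensional window_nth mem_cells
        intro: inj_on_window fillings_on_less\<close>)
qed

lemma juxtapose_in_fillings_on:
  assumes G: "G \<in> fillings_on j k S" and H: "H \<in> fillings_on m k (V - S)" and "S \<subseteq> V"
  shows "juxtapose j m k G H \<in> fillings_on (j + m) k V"
    and "juxtapose j m k G H ` cells j k = S"
proof -
  let ?F = "juxtapose j m k G H" and ?s = "\<lambda>(r, c). (r, c + j)"
  have 1: "?F p = G p" if "p \<in> cells j k" for p
    using that by (cases p) (auto simp: juxtapose_def mem_cells)
  have 2: "?F (?s p) = H p" if "p \<in> cells m k" for p
    using that by (cases p) (auto simp: juxtapose_def mem_cells)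
  have im1: "?F ` cells j k = S"
    using fillings_onD(2)[OF G] 1 by (metis image_cong)
  have im2: "?F ` ?s ` cells m k = V - S"
    using fillings_onD(2)[OF H] 2 unfolding image_image by (metis (no_types, lifting) image_cong)
  have inj1: "inj_on ?F (cells j k)"
    using fillings_onD(1)[OF G] 1 by (simp cong: inj_on_cong)
  have inj2: "inj_on ?F (?s ` cells m k)"
  proof (rule inj_onI)
    fix x y assume "x \<in> ?s ` cells m k" "y \<in> ?s ` cells m k" and eq: "?F x = ?F y"
    then obtain p q where pq: "p \<in> cells m k" "q \<in> cells m k" and "x = ?s p" "y = ?s q"
      by blast
    with eq 2 have "H p = H q" by simp
    then have "p = q" using fillings_onD(1)[OF H] pq by (auto dest: inj_onD)
    then show "x = y" using \<open>x = ?s p\<close> \<open>y = ?s q\<close> by simp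
  qed
  show "?F ` cells j k = S" by (rule im1)
  show "?F \<in> fillings_on (j + m) k V"
  proof (rule fillings_onI)
    show "?F \<in> extensional (cells (j + m) k)" by (simp add: juxtapose_def)
    show "?F ` cells (j + m) k = V"
      unfolding cells_add(1) image_Un im1 im2 using \<open>S \<subseteq> V\<close> by blast
    show "inj_on ?F (cells (j + m) k)"
      unfolding cells_add(1) inj_on_Un using inj1 inj2 im1 im2 by blast
    fix r s c assume *: "1 \<le> r" "r < s" "s \<le> k" "1 \<le> c" "c \<le> j + m"
    show "?F (r, c) < ?F (s, c)"
    proof (cases "c \<le> j")
      case True
      then show ?thesis using fillings_on_less[OF G, of r s c] *
        by (simp add: juxtapose_def mem_cells)
    next
      case False
      then show ?thesis using fillings_on_less[OF H, of r s "c - j"] *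
        by (simp add: juxtapose_def mem_cells)
    qed
  qed
qed

section \<open>Sums over fillings\<close>

lemma strict_mono_on_inv_into:
  fixes h :: "nat \<Rightarrow> nat"
  assumes "bij_betw h U V" "strict_mono_on U h"
  shows "strict_mono_on V (inv_into U h)"
proof (rule strict_mono_onI)
  fix x y assume xy: "x \<in> V" "y \<in> V" "x < y"
  have "inv_into U h x \<in> U" "inv_into U h y \<in> U"
    using bij_betw_apply[OF bij_betw_inv_into[OF assms(1)]] xy by auto
  moreover have "h (inv_into U h x) < h (inv_into U h y)"
    using bij_betw_inv_into_right[OF assms(1)] xy by simp
  ultimately show "inv_into U h x < inv_into U h y"
    using assms(2) by (simp add: strict_mono_on_less)
qed

lemma ex_strict_mono_bij_betw:
  fixes U V :: "nat set"
  assumes "finite U" "finite V" "card U = card V"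
  obtains h where "bij_betw h U V" "strict_mono_on U h"
proof -
  obtain f where f: "bij_betw f {..<card U} U" "strict_mono_on {..<card U} f"
    using ex_bij_betw_strict_mono_card[OF \<open>finite U\<close>] by blast
  obtain g where g: "bij_betw g {..<card U} V" "strict_mono_on {..<card U} g"
    using ex_bij_betw_strict_mono_card[OF \<open>finite V\<close>] assms(3) by metis
  let ?i = "inv_into {..<card U} f"
  have i: "bij_betw ?i U {..<card U}" using f(1) by (rule bij_betw_inv_into)
  have "strict_mono_on U (g \<circ> ?i)"
    using g(2) strict_mono_on_inv_into[OF f] bij_betw_apply[OF i]
    by (fastforce simp: strict_mono_on_def)
  with bij_betw_trans[OF i g(1)] show ?thesis by (rule that)
qed

lemma relabel_in_fillings_on:
  assumes F: "F \<in> fillings_on n k U" and h: "bij_betw h U V" "strict_mono_on U h"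
  shows "restrict (h \<circ> F) (cells n k) \<in> fillings_on n k V" (is "?G \<in> _")
    and "same_order (cells n k) F (restrict (h \<circ> F) (cells n k))"
proof -
  have FU: "F p \<in> U" if "p \<in> cells n k" for p
    using fillings_onD(2)[OF F] that by blast
  have "bij_betw (h \<circ> F) (cells n k) V"
    using F h(1) by (auto simp: fillings_on_def intro: bij_betw_trans)
  then have "bij_betw ?G (cells n k) V" by (simp cong: bij_betw_cong)
  moreover have "?G (r, c) < ?G (s, c)" if "1 \<le> r" "r < s" "s \<le> k" "1 \<le> c" "c \<le> n" for r s c
    using that fillings_on_less[OF F that] FU h(2) by (auto simp: mem_cells strict_mono_on_def)
  ultimately show "?G \<in> fillings_on n k V"
    by (intro fillings_onI) (auto simp: bij_betw_def)
  show "same_order (cells n k) F ?G"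
    using FU h(2) by (auto simp: same_order_def strict_mono_on_less_eq)
qed

text \<open>
  A statistic that depends only on the relative order of the entries, for arrays with distinct
  entries.
\<close>

definition order_invariant :: "nat \<Rightarrow> nat \<Rightarrow> (filling \<Rightarrow> 'a) \<Rightarrow> bool" where
  "order_invariant n k f \<longleftrightarrow>
     (\<forall>F G. inj_on F (cells n k) \<and> same_order (cells n k) F G \<longrightarrow> f F = f G)"

lemma order_invariant_matches: "order_invariant n k (\<lambda>F. f (matches \<Upsilon> n k F))"
  unfolding order_invariant_def by (metis matches_cong)

text \<open>An order-preserving relabelling identifies \<open>fillings_on n k V\<close> with \<open>fillings n k\<close>.\<close>

lemma sum_fillings_on:
  assumes f: "order_invariant n k f" and V: "finite V" "card V = k * n"
  shows "sum f (fillings_on n k V) = sum f (fillings n k)"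
proof -
  obtain h where h: "bij_betw h {1..k * n} V" "strict_mono_on {1..k * n} h"
    using ex_strict_mono_bij_betw[of "{1..k * n}" V] V by auto
  let ?g = "inv_into {1..k * n} h" and ?r = "\<lambda>h F. restrict (h \<circ> F) (cells n k)"
  have g: "bij_betw ?g V {1..k * n}" "strict_mono_on V ?g"
    using bij_betw_inv_into[OF h(1)] strict_mono_on_inv_into[OF h] .
  have "?r ?g (?r h F) = F" if "F \<in> fillings n k" for F
  proof (rule extensionalityI)
    note F = fillings_onD[OF that[unfolded fillings_eq]]
    show "F \<in> extensional (cells n k)" by (rule F(3))
    fix p assume "p \<in> cells n k"
    moreover from this have "F p \<in> {1..k * n}" using F(2) by blast
    ultimately show "?r ?g (?r h F) p = F p" using bij_betw_inv_into_left[OF h(1)] by simp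
  qed simp
  moreover have "?r h (?r ?g F) = F" if "F \<in> fillings_on n k V" for F
  proof (rule extensionalityI)
    note F = fillings_onD[OF that]
    show "F \<in> extensional (cells n k)" by (rule F(3))
    fix p assume "p \<in> cells n k"
    moreover from this have "F p \<in> V" using F(2) by blast
    ultimately show "?r h (?r ?g F) p = F p" using bij_betw_inv_into_right[OF h(1)] by simp
  qed simp
  ultimately have "bij_betw (?r h) (fillings n k) (fillings_on n k V)"
    using relabel_in_fillings_on(1)[OF _ h] relabel_in_fillings_on(1)[OF _ g]
    by (intro bij_betw_byWitness[where f' = "?r ?g"]) (auto simp: fillings_eq)
  moreover have "f (?r h F) = f F" if "F \<in> fillings n k" for F
    using f relabel_in_fillings_on(2)[OF that[unfolded fillings_eq] h]
      fillings_onD(1)[OF that[unfolded fillings_eq]]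
    unfolding order_invariant_def by metis
  ultimately show ?thesis
    using sum.reindex_bij_betw[of "?r h" "fillings n k" "fillings_on n k V" f] by (simp cong: sum.cong)
qed

text \<open>
  A filling with \<open>j + m\<close> columns is determined by the set \<open>S\<close> of entries of its first \<open>j\<close> columns,
  and fillings of the two parts with the entries in \<open>S\<close> and in its complement, which can be chosen
  independently.
\<close>

lemma sum_fillings_split:
  fixes f g :: "filling \<Rightarrow> 'a::comm_semiring_1"
  assumes f: "order_invariant j k f" and g: "order_invariant m k g"
  shows "(\<Sum>F\<in>fillings (j + m) k. f (window 0 j k F) * g (window j m k F)) =
    of_nat ((k * (j + m)) choose (k * j)) * sum f (fillings j k) * sum g (fillings m k)"
proof -
  let ?V = "{1..k * (j + m)}"
  let ?\<S> = "{S. S \<subseteq> ?V \<and> card S = k * j}"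
  let ?T = "SIGMA S:?\<S>. fillings_on j k S \<times> fillings_on m k (?V - S)"
  have fin: "finite (fillings_on i k S)" if "finite S" for i S
  proof (rule finite_subset)
    show "fillings_on i k S \<subseteq> PiE (cells i k) (\<lambda>_. S)"
      by (auto simp: fillings_on_def PiE_def dest: bij_betwE)
    show "finite (PiE (cells i k) (\<lambda>_. S))"
      using that by (intro finite_PiE finite_cells)
  qed
  have fin': "finite S" if "S \<in> ?\<S>" for S
    using that finite_subset[of S ?V] by simp
  have finT: "\<forall>S\<in>?\<S>. finite (fillings_on j k S \<times> fillings_on m k (?V - S))"
    using fin fin' by blast
  have "(\<Sum>F\<in>fillings (j + m) k. f (window 0 j k F) * g (window j m k F)) =
      (\<Sum>(S, G, H)\<in>?T. f G * g H)"
  proof (rule sum.reindex_bij_witness)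
    fix F assume "F \<in> fillings (j + m) k"
    then have F: "F \<in> fillings_on (j + m) k ?V" by (simp add: fillings_eq)
    show "(case (F ` cells j k, window 0 j k F, window j m k F) of
        (S, G, H) \<Rightarrow> juxtapose j m k G H) = F"
      using juxtapose_window[OF fillings_onD(3)[OF F]] by simp
    have sub: "cells j k \<subseteq> cells (j + m) k" by (auto simp: mem_cells)
    have "card (F ` cells j k) = k * j"
      using card_image[OF inj_on_subset[OF fillings_onD(1)[OF F] sub]] by (simp add: card_cells)
    moreover have "F ` cells j k \<subseteq> ?V" using fillings_onD(2)[OF F] sub by blast
    ultimately show "(F ` cells j k, window 0 j k F, window j m k F) \<in> ?T"
      using window_in_fillings_on[OF F] by simp
  next
    fix x assume "x \<in> ?T"
    then obtain S G H where x: "x = (S, G, H)" and S: "S \<in> ?\<S>"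
      and G: "G \<in> fillings_on j k S" and H: "H \<in> fillings_on m k (?V - S)" by blast
    note J = juxtapose_in_fillings_on[OF G H]
    note W = window_juxtapose[OF fillings_onD(3)[OF G] fillings_onD(3)[OF H]]
    show "(\<lambda>F. (F ` cells j k, window 0 j k F, window j m k F))
        (case x of (S, G, H) \<Rightarrow> juxtapose j m k G H) = x"
      using J(2) W S by (simp add: x)
    show "(case x of (S, G, H) \<Rightarrow> juxtapose j m k G H) \<in> fillings (j + m) k"
      using J(1) S by (simp add: x fillings_eq)
  qed auto
  also have "\<dots> = (\<Sum>S\<in>?\<S>. \<Sum>(G, H)\<in>fillings_on j k S \<times> fillings_on m k (?V - S). f G * g H)"
    by (rule sum.Sigma[symmetric]) (use finT in simp_all)
  also have "\<dots> = (\<Sum>S\<in>?\<S>. sum f (fillings_on j k S) * sum g (fillings_on m k (?V - S)))"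
    by (simp add: sum.cartesian_product sum_product)
  also have "\<dots> = (\<Sum>S\<in>?\<S>. sum f (fillings j k) * sum g (fillings m k))"
  proof (rule sum.cong[OF refl])
    fix S assume S: "S \<in> ?\<S>"
    then have "card (?V - S) = k * m"
      using card_Diff_subset[of S ?V] fin'[OF S] by (simp add: algebra_simps)
    then show "sum f (fillings_on j k S) * sum g (fillings_on m k (?V - S)) =
        sum f (fillings j k) * sum g (fillings m k)"
      using sum_fillings_on[OF f, of S] sum_fillings_on[OF g, of "?V - S"] S fin'[OF S] by simp
  qed
  also have "\<dots> = of_nat ((k * (j + m)) choose (k * j)) * sum f (fillings j k) * sum g (fillings m k)"
    using n_subsets[of ?V "k * j"] by (simp add: mult.assoc)
  finally show ?thesis .
qed

lemma fillings_0: "fillings 0 k = {\<lambda>_. undefined}"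
  by (auto simp: fillings_def cells_def bij_betw_def)

lemma card_fillings_1: "card (fillings 1 k) = 1"
proof -
  \<comment> \<open>All fillings with a single column have the relative order of the row numbers.\<close>
  have so: "same_order (cells 1 k) F fst" if "F \<in> fillings 1 k" for F
    unfolding same_order_def
  proof (intro ballI)
    fix p q assume pq: "p \<in> cells 1 k" "q \<in> cells 1 k"
    obtain r s where [simp]: "p = (r, 1)" "q = (s, 1)"
      using pq by (cases p, cases q) (auto simp: mem_cells)
    have "strict_mono_on {1..k} (\<lambda>r. F (r, 1))" using that by (auto simp: fillings_def)
    then have "F (r, 1) \<le> F (s, 1) \<longleftrightarrow> r \<le> s"
      using pq strict_mono_on_less_eq[of "{1..k}" "\<lambda>r. F (r, 1)" r s] by (simp add: mem_cells)
    then show "F p \<le> F q \<longleftrightarrow> fst p \<le> fst q" by simp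
  qed
  have eq: "F = red 1 k fst" if F: "F \<in> fillings 1 k" for F
    using red_cong[OF so[OF F]] red_filling[OF F] fillings_onD(1)[OF F[unfolded fillings_eq]]
    by simp
  have mem: "restrict fst (cells 1 k) \<in> fillings 1 k"
    unfolding fillings_eq
  proof (rule fillings_onI)
    show "restrict fst (cells 1 k) ` cells 1 k = {1..k * 1}"
      by (simp add: cells_def)
  qed (auto simp: mem_cells inj_on_def)
  have "fillings 1 k = {red 1 k fst}"
    using eq mem by (metis is_singletonI' is_singleton_the_elem empty_iff singletonD)
  then show ?thesis by simp
qed

section \<open>Greedy choice of nonoverlapping matches\<close>

text \<open>The maximum number of nonoverlapping matches, as a function of the set of matches.\<close>

definition max_nonoverlapping :: "nat set \<Rightarrow> nat" where
  "max_nonoverlapping M = Max {card T | T. T \<subseteq> M \<and> pairwise (\<lambda>i j. \<not> overlap i j) T}"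

lemma nlap_eq: "nlap \<Upsilon> n k F = max_nonoverlapping (matches \<Upsilon> n k F)"
  by (simp add: nlap_def max_nonoverlapping_def)

lemma overlap_iff: "overlap i j \<longleftrightarrow> i \<le> j + 1 \<and> j \<le> i + 1"
  by (auto simp: overlap_def)

lemma max_nonoverlapping_set:
  fixes M :: "nat set"
  assumes "finite M"
  defines "A \<equiv> {card T | T. T \<subseteq> M \<and> pairwise (\<lambda>i j. \<not> overlap i j) T}"
  shows "finite A" "A \<noteq> {}"
proof -
  have "finite (card ` Pow M)" using assms(1) by simp
  then show "finite A" by (rule rev_finite_subset) (auto simp: A_def)
  have "card {} \<in> A" unfolding A_def by (auto intro!: exI[of _ "{}"])
  then show "A \<noteq> {}" by blast
qed

lemma card_le_max_nonoverlapping: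
  assumes "finite M" "T \<subseteq> M" "pairwise (\<lambda>i j. \<not> overlap i j) T"
  shows "card T \<le> max_nonoverlapping M"
  unfolding max_nonoverlapping_def
  using assms by (intro Max_ge max_nonoverlapping_set) auto

lemma max_nonoverlapping_attained:
  assumes "finite M"
  obtains T where "T \<subseteq> M" "pairwise (\<lambda>i j. \<not> overlap i j) T" "card T = max_nonoverlapping M"
  using Max_in[OF max_nonoverlapping_set[OF assms]] unfolding max_nonoverlapping_def by auto

lemma max_nonoverlapping_empty: "max_nonoverlapping {} = 0"
  by (rule max_nonoverlapping_attained[of "{}"]) auto

lemma max_nonoverlapping_shift: "max_nonoverlapping ((\<lambda>i. i + a) ` M) = max_nonoverlapping M"
proof -
  have "{card T | T. T \<subseteq> (\<lambda>i. i + a) ` M \<and> pairwise (\<lambda>i j. \<not> overlap i j) T} =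
      {card ((\<lambda>i. i + a) ` T) | T. T \<subseteq> M \<and> pairwise (\<lambda>i j. \<not> overlap i j) ((\<lambda>i. i + a) ` T)}"
    unfolding subset_image_iff by blast
  also have "\<dots> = {card T | T. T \<subseteq> M \<and> pairwise (\<lambda>i j. \<not> overlap i j) T}"
    by (simp add: card_image pairwise_def overlap_iff)
  finally show ?thesis by (simp add: max_nonoverlapping_def)
qed

text \<open>
  The greedy step: some maximum set of nonoverlapping matches contains the first match \<open>Min M\<close>, and
  its other elements start to the right of the two columns occupied by this match.
\<close>

lemma max_nonoverlapping_Min:
  assumes M: "finite M" "M \<noteq> {}"
  shows "max_nonoverlapping M = Suc (max_nonoverlapping {i \<in> M. Min M + 1 < i})"
proof (rule antisym)
  let ?m = "Min M"
  let ?M' = "{i \<in> M. ?m + 1 < i}"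
  have fin: "finite ?M'" using M by simp
  have Min: "?m \<in> M" "\<And>i. i \<in> M \<Longrightarrow> ?m \<le> i" using M by auto
  obtain T where T: "T \<subseteq> M" "pairwise (\<lambda>i j. \<not> overlap i j) T" "card T = max_nonoverlapping M"
    using max_nonoverlapping_attained[OF M(1)] .
  have "finite T" using T(1) M(1) by (rule finite_subset)
  \<comment> \<open>At most one element of \<open>T\<close> overlaps with the first match.\<close>
  have "card (T \<inter> {?m, ?m + 1}) \<le> 1"
    using pairwiseD[OF T(2), of ?m "?m + 1"] by (auto simp: card_le_Suc0_iff_eq overlap_iff)
  moreover have "card (T - {?m, ?m + 1}) \<le> max_nonoverlapping ?M'"
  proof (rule card_le_max_nonoverlapping[OF fin])
    show "T - {?m, ?m + 1} \<subseteq> ?M'"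
    proof
      fix i assume i: "i \<in> T - {?m, ?m + 1}"
      then have "i \<in> M" using T(1) by blast
      with i Min(2)[of i] show "i \<in> ?M'" by auto
    qed
  qed (use T(2) in \<open>auto intro: pairwise_subset\<close>)
  moreover have "card T = card (T \<inter> {?m, ?m + 1}) + card (T - {?m, ?m + 1})"
    using \<open>finite T\<close> by (subst card_Un_disjoint[symmetric]) (auto intro: arg_cong[where f = card])
  ultimately show "max_nonoverlapping M \<le> Suc (max_nonoverlapping ?M')"
    using T(3) by linarith
  obtain T' where T': "T' \<subseteq> ?M'" "pairwise (\<lambda>i j. \<not> overlap i j) T'"
    "card T' = max_nonoverlapping ?M'"
    using max_nonoverlapping_attained[OF fin] .
  have "finite T'" "?m \<notin> T'" using T'(1) fin by (auto intro: finite_subset)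
  then have "card (insert ?m T') = Suc (max_nonoverlapping ?M')" using T'(3) by simp
  moreover have "card (insert ?m T') \<le> max_nonoverlapping M"
    using T'(1,2) Min(1)
    by (intro card_le_max_nonoverlapping[OF M(1)]) (auto simp: pairwise_insert overlap_iff)
  ultimately show "Suc (max_nonoverlapping ?M') \<le> max_nonoverlapping M" by simp
qed

section \<open>Recurrences\<close>

text \<open>
  The number of fillings with \<open>n\<close> columns whose only match occupies the last two columns.  As
  positions of matches are positive, it is 0 for \<open>n \<le> 1\<close>.
\<close>

definition end_match_count :: "filling set \<Rightarrow> nat \<Rightarrow> nat \<Rightarrow> nat" where
  "end_match_count \<Upsilon> n k = card {F \<in> fillings n k. matches \<Upsilon> n k F = {n - 1}}"

lemma matches_0: "matches \<Upsilon> 0 k F = {}"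
  by (auto simp: matches_def)

lemma end_match_count_0: "end_match_count \<Upsilon> 0 k = 0"
  by (simp add: end_match_count_def matches_0)

lemma match_free_count_0: "match_free_count \<Upsilon> 0 k = 1"
  by (simp add: match_free_count_def matches_0 fillings_0)

lemma sum_of_bool_fillings:
  "(\<Sum>F\<in>fillings n k. of_bool (P F)) = of_nat (card {F \<in> fillings n k. P F})"
  by (simp add: finite_fillings Int_def)

text \<open>Appending a column to a match-free filling creates at most one match, at the end.\<close>

lemma match_free_count_Suc:
  "match_free_count \<Upsilon> (Suc n) k + end_match_count \<Upsilon> (Suc n) k =
     (k * Suc n choose k * n) * match_free_count \<Upsilon> n k"
proof -
  have iff: "matches \<Upsilon> n k (window 0 n k F) = {} \<longleftrightarrow>
      matches \<Upsilon> (Suc n) k F = {} \<or> matches \<Upsilon> (Suc n) k F = {n}"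
    if "F \<in> fillings (Suc n) k" for F
  proof -
    have "i \<in> matches \<Upsilon> n k (window 0 n k F) \<longleftrightarrow> i \<in> {1..n - 1} \<and> i \<in> matches \<Upsilon> (Suc n) k F" for i
      using mem_matches_window'[OF fillings_onD(1)[OF that[unfolded fillings_eq]]] by simp
    moreover have "matches \<Upsilon> (Suc n) k F \<subseteq> {1..n}" by (auto simp: matches_def)
    moreover have "{1..n} - {n} = {1..n - 1}" by auto
    ultimately have "matches \<Upsilon> n k (window 0 n k F) = matches \<Upsilon> (Suc n) k F - {n}"
      by blast
    then show ?thesis by blast
  qed
  have "(k * Suc n choose k * n) * match_free_count \<Upsilon> n k =
      of_nat ((k * (n + 1)) choose (k * n)) *
        (\<Sum>F\<in>fillings n k. of_bool (matches \<Upsilon> n k F = {})) * (\<Sum>F\<in>fillings 1 k. 1)"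
    by (simp only: sum_of_bool_fillings card_eq_sum[symmetric] card_fillings_1 match_free_count_def)
      simp
  also have "\<dots> = (\<Sum>F\<in>fillings (n + 1) k. of_bool (matches \<Upsilon> n k (window 0 n k F) = {}) * 1)"
    by (rule sum_fillings_split[symmetric, OF order_invariant_matches])
      (simp add: order_invariant_def)
  also have "\<dots> = (\<Sum>F\<in>fillings (Suc n) k. of_bool (matches \<Upsilon> (Suc n) k F = {}) +
      of_bool (matches \<Upsilon> (Suc n) k F = {n}))"
    by (rule sum.cong) (auto simp: iff)
  also have "\<dots> = match_free_count \<Upsilon> (Suc n) k + end_match_count \<Upsilon> (Suc n) k"
    unfolding sum.distrib sum_of_bool_fillings match_free_count_def end_match_count_def by simp
  finally show ?thesis by simp
qed

text \<open>The distribution of \<open>nlap\<close> on the fillings with \<open>n\<close> columns, as a polynomial in \<open>x\<close>.\<close>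

definition nlap_poly :: "filling set \<Rightarrow> nat \<Rightarrow> nat \<Rightarrow> rat poly" where
  "nlap_poly \<Upsilon> n k = (\<Sum>F\<in>fillings n k. [:0, 1:] ^ nlap \<Upsilon> n k F)"

text \<open>
  If \<open>F\<close> has a match, only the term where column \<open>j\<close> is the last column of the first match is
  nonzero in the sum over \<open>j\<close>.  For \<open>j = 0\<close> and \<open>j = 1\<close>, \<open>j - 1\<close> is 0, which is never the position
  of a match.
\<close>

lemma power_nlap_eq:
  fixes x :: "'a::comm_semiring_1"
  assumes F: "F \<in> fillings n k"
  shows "x ^ nlap \<Upsilon> n k F = of_bool (matches \<Upsilon> n k F = {}) +
    (\<Sum>j\<le>n. x * (of_bool (matches \<Upsilon> j k (window 0 j k F) = {j - 1}) *
      x ^ nlap \<Upsilon> (n - j) k (window j (n - j) k F)))"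
proof -
  let ?M = "matches \<Upsilon> n k F"
  note inj = fillings_onD(1)[OF F[unfolded fillings_eq]]
  have sub: "?M \<subseteq> {1..n - 1}" by (auto simp: matches_def)
  then have fin: "finite ?M" by (rule finite_subset) simp
  have pre: "matches \<Upsilon> j k (window 0 j k F) = ?M \<inter> {1..j - 1}" if "j \<le> n" for j
    using mem_matches_window'[OF inj, of 0 j] that by auto
  show ?thesis
  proof (cases "?M = {}")
    case True
    then show ?thesis by (simp add: nlap_eq max_nonoverlapping_empty pre)
  next
    case False
    let ?m = "Min ?M"
    have Min: "?m \<in> ?M" "\<And>i. i \<in> ?M \<Longrightarrow> ?m \<le> i" using fin False by auto
    have "?m \<in> {1..n - 1}" using Min(1) sub by blast
    then have m: "1 \<le> ?m" "?m + 1 \<le> n" by auto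
    have first: "?M \<inter> {1..?m} = {?m}"
    proof (intro equalityI subsetI)
      fix i assume "i \<in> ?M \<inter> {1..?m}"
      then have "?m \<le> i" "i \<le> ?m" using Min(2) by simp_all
      then show "i \<in> {?m}" by simp
    qed (use Min(1) m in simp)
    have "matches \<Upsilon> j k (window 0 j k F) = {j - 1} \<longleftrightarrow> j = ?m + 1" if "j \<le> n" for j
    proof
      assume "j = ?m + 1"
      then have "j - 1 = ?m" by simp
      then show "matches \<Upsilon> j k (window 0 j k F) = {j - 1}"
        by (simp only: pre[OF that] first)
    next
      assume *: "matches \<Upsilon> j k (window 0 j k F) = {j - 1}"
      then have j: "j - 1 \<in> ?M" "?M \<inter> {1..j - 1} = {j - 1}" using pre[OF that] by auto
      then have "?m \<le> j - 1" using Min(2) by blast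
      then have "?m \<in> ?M \<inter> {1..j - 1}" using Min(1) m by simp
      then have "?m \<in> {j - 1}" by (simp only: j(2))
      then show "j = ?m + 1" using m by auto
    qed
    moreover have "nlap \<Upsilon> n k F = Suc (nlap \<Upsilon> (n - (?m + 1)) k (window (?m + 1) (n - (?m + 1)) k F))"
    proof -
      let ?j = "?m + 1"
      have suf: "i \<in> matches \<Upsilon> (n - ?j) k (window ?j (n - ?j) k F) \<longleftrightarrow>
          i \<in> {1..n - ?j - 1} \<and> i + ?j \<in> ?M" for i
        by (rule mem_matches_window'[OF inj]) (use m in simp)
      have "{i \<in> ?M. ?j < i} = (\<lambda>i. i + ?j) ` matches \<Upsilon> (n - ?j) k (window ?j (n - ?j) k F)"
      proof (intro set_eqI iffI)
        fix i assume i: "i \<in> {i \<in> ?M. ?j < i}"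
        then have "i \<le> n - 1" using sub by auto
        then have "i - ?j \<in> matches \<Upsilon> (n - ?j) k (window ?j (n - ?j) k F)"
          using i unfolding suf by auto
        then show "i \<in> (\<lambda>i. i + ?j) ` matches \<Upsilon> (n - ?j) k (window ?j (n - ?j) k F)"
          by (rule rev_image_eqI) (use i in auto)
      next
        fix i assume "i \<in> (\<lambda>i. i + ?j) ` matches \<Upsilon> (n - ?j) k (window ?j (n - ?j) k F)"
        then obtain l where "l \<in> matches \<Upsilon> (n - ?j) k (window ?j (n - ?j) k F)" "i = l + ?j"
          by blast
        then show "i \<in> {i \<in> ?M. ?j < i}" unfolding suf by simp
      qed
      then show ?thesis
        unfolding nlap_eq using max_nonoverlapping_Min[OF fin False]
        by (simp only: max_nonoverlapping_shift)
    qed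
    ultimately have "(\<Sum>j\<le>n. x * (of_bool (matches \<Upsilon> j k (window 0 j k F) = {j - 1}) *
        x ^ nlap \<Upsilon> (n - j) k (window j (n - j) k F))) =
        (\<Sum>j\<le>n. if j = ?m + 1 then x ^ nlap \<Upsilon> n k F else 0)"
      by (intro sum.cong) auto
    also have "\<dots> = x ^ nlap \<Upsilon> n k F" using m by simp
    finally show ?thesis using False by simp
  qed
qed

lemma nlap_poly_rec:
  "nlap_poly \<Upsilon> n k = of_nat (match_free_count \<Upsilon> n k) +
     [:0, 1:] * (\<Sum>j\<le>n. of_nat (k * n choose k * j) * of_nat (end_match_count \<Upsilon> j k) *
       nlap_poly \<Upsilon> (n - j) k)"
proof -
  let ?f = "\<lambda>j F. of_bool (matches \<Upsilon> j k F = {j - 1}) :: rat poly"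
  let ?g = "\<lambda>j F. [:0, 1:] ^ nlap \<Upsilon> (n - j) k F :: rat poly"
  have "nlap_poly \<Upsilon> n k = (\<Sum>F\<in>fillings n k. of_bool (matches \<Upsilon> n k F = {}) +
      (\<Sum>j\<le>n. [:0, 1:] * (?f j (window 0 j k F) * ?g j (window j (n - j) k F))))"
    unfolding nlap_poly_def by (intro sum.cong refl power_nlap_eq)
  also have "\<dots> = of_nat (match_free_count \<Upsilon> n k) + [:0, 1:] *
      (\<Sum>j\<le>n. \<Sum>F\<in>fillings n k. ?f j (window 0 j k F) * ?g j (window j (n - j) k F))"
    unfolding sum.distrib sum_of_bool_fillings match_free_count_def
    by (subst sum.swap) (simp only: sum_distrib_left)
  also have "(\<Sum>j\<le>n. \<Sum>F\<in>fillings n k. ?f j (window 0 j k F) * ?g j (window j (n - j) k F)) =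
      (\<Sum>j\<le>n. of_nat (k * n choose k * j) * of_nat (end_match_count \<Upsilon> j k) *
        nlap_poly \<Upsilon> (n - j) k)"
  proof (rule sum.cong[OF refl])
    fix j assume "j \<in> {..n}"
    then have j: "j + (n - j) = n" by simp
    have "order_invariant (n - j) k (?g j)"
      unfolding nlap_eq by (rule order_invariant_matches)
    from sum_fillings_split[OF order_invariant_matches[of j k "\<lambda>M. of_bool (M = {j - 1})" \<Upsilon>] this]
    show "(\<Sum>F\<in>fillings n k. ?f j (window 0 j k F) * ?g j (window j (n - j) k F)) =
        of_nat (k * n choose k * j) * of_nat (end_match_count \<Upsilon> j k) * nlap_poly \<Upsilon> (n - j) k"
      unfolding j sum_of_bool_fillings end_match_count_def nlap_poly_def .
  qed
  finally show ?thesis .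
qed

section \<open>Generating functions\<close>

text \<open>
  The generating function of the fillings whose only match occupies the last two columns, with
  the weight \<open>t ^ n / (k * n)!\<close> for \<open>n\<close> columns.
\<close>

definition B_series :: "filling set \<Rightarrow> nat \<Rightarrow> rat poly fps" where
  "B_series \<Upsilon> k = Abs_fps (\<lambda>n. [:of_nat (end_match_count \<Upsilon> n k) / fact (k * n):])"

lemma A_series_nth:
  "fps_nth (A_series \<Upsilon> k) n = [:of_nat (match_free_count \<Upsilon> n k) / fact (k * n):]"
  by (simp add: A_series_def match_free_count_0 one_pCons)

lemma N_series_nth: "fps_nth (N_series \<Upsilon> k) n = smult (1 / fact (k * n)) (nlap_poly \<Upsilon> n k)"
  by (simp add: N_series_def nlap_poly_def fillings_0 nlap_eq matches_0
      max_nonoverlapping_empty)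

lemma B_series_eq:
  "B_series \<Upsilon> k = 1 + (fps_const [:1 / fact k:] * fps_X - 1) * A_series \<Upsilon> k"
proof (rule fps_ext)
  fix n
  have eq: "1 + (fps_const [:1 / fact k:] * fps_X - 1) * A_series \<Upsilon> k =
      1 + fps_const [:1 / fact k:] * (fps_X * A_series \<Upsilon> k) - A_series \<Upsilon> k"
    by (simp add: algebra_simps)
  show "fps_nth (B_series \<Upsilon> k) n =
      fps_nth (1 + (fps_const [:1 / fact k:] * fps_X - 1) * A_series \<Upsilon> k) n"
  proof (cases n)
    case 0
    then show ?thesis
      unfolding eq by (simp add: B_series_def A_series_nth end_match_count_0 match_free_count_0 one_pCons)
  next
    case (Suc m)
    have C: "(of_nat (k * Suc m choose k * m) :: rat) = fact (k * Suc m) / (fact (k * m) * fact k)"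
      by (subst binomial_fact) auto
    have "of_nat (match_free_count \<Upsilon> (Suc m) k) + of_nat (end_match_count \<Upsilon> (Suc m) k) =
        (of_nat (k * Suc m choose k * m) * of_nat (match_free_count \<Upsilon> m k) :: rat)"
      using arg_cong[OF match_free_count_Suc, of of_nat] by (simp only: of_nat_add of_nat_mult)
    then have E: "(of_nat (end_match_count \<Upsilon> (Suc m) k) :: rat) =
        fact (k * Suc m) / (fact (k * m) * fact k) * of_nat (match_free_count \<Upsilon> m k) -
        of_nat (match_free_count \<Upsilon> (Suc m) k)"
      unfolding C by linarith
    have "(of_nat (end_match_count \<Upsilon> (Suc m) k) :: rat) / fact (k * Suc m) =
        1 / fact k * (of_nat (match_free_count \<Upsilon> m k) / fact (k * m)) -
        of_nat (match_free_count \<Upsilon> (Suc m) k) / fact (k * Suc m)"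
      unfolding E by (simp add: diff_divide_distrib mult_ac del: mult_Suc_right)
    then show ?thesis
      unfolding eq Suc by (simp add: B_series_def A_series_nth del: mult_Suc_right)
  qed
qed

lemma smult_sum_right: "smult c (sum f A) = (\<Sum>i\<in>A. smult c (f i))"
  by (induction A rule: infinite_finite_induct) (simp_all add: smult_add_right)

lemma N_series_eq:
  "N_series \<Upsilon> k = A_series \<Upsilon> k + fps_const [:0, 1:] * (B_series \<Upsilon> k * N_series \<Upsilon> k)"
proof (rule fps_ext)
  fix n
  have "smult (1 / fact (k * n)) (of_nat (k * n choose k * j) * of_nat (end_match_count \<Upsilon> j k) *
        nlap_poly \<Upsilon> (n - j) k) =
      fps_nth (B_series \<Upsilon> k) j * fps_nth (N_series \<Upsilon> k) (n - j)" if "j \<le> n" for j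
  proof -
    have "k * n - k * j = k * (n - j)" by (simp add: diff_mult_distrib2)
    then have eq: "(of_nat (k * n choose k * j) :: rat) / fact (k * n) =
        1 / (fact (k * j) * fact (k * (n - j)))"
      using that by (subst binomial_fact) auto
    have "smult (1 / fact (k * n)) (of_nat (k * n choose k * j) * of_nat (end_match_count \<Upsilon> j k) *
        nlap_poly \<Upsilon> (n - j) k) =
        smult (of_nat (k * n choose k * j) / fact (k * n) * of_nat (end_match_count \<Upsilon> j k))
          (nlap_poly \<Upsilon> (n - j) k)"
      by (simp add: of_nat_poly mult_ac)
    then show ?thesis
      unfolding eq by (simp add: B_series_def N_series_nth mult.commute)
  qed
  then have "fps_nth (B_series \<Upsilon> k * N_series \<Upsilon> k) n = smult (1 / fact (k * n))
      (\<Sum>j\<le>n. of_nat (k * n choose k * j) * of_nat (end_match_count \<Upsilon> j k) *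
        nlap_poly \<Upsilon> (n - j) k)"
    by (simp add: fps_mult_nth atLeast0AtMost smult_sum_right)
  moreover have "fps_nth (N_series \<Upsilon> k) n = smult (1 / fact (k * n)) (nlap_poly \<Upsilon> n k)"
    by (rule N_series_nth)
  ultimately show "fps_nth (N_series \<Upsilon> k) n =
      fps_nth (A_series \<Upsilon> k + fps_const [:0, 1:] * (B_series \<Upsilon> k * N_series \<Upsilon> k)) n"
    unfolding nlap_poly_rec[of \<Upsilon> n k]
    by (simp add: A_series_nth smult_add_right of_nat_poly)
qed

theorem theorem3:
  fixes k :: nat and \<Upsilon> :: "filling set"
  assumes "k \<ge> 1" and "\<Upsilon> \<subseteq> fillings 2 k"
  shows "N_series \<Upsilon> k =
    fps_quot (A_series \<Upsilon> k)
      (1 - fps_const [:0, 1:] *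
        (1 + (fps_const [:1 / fact k:] * fps_X - 1) * A_series \<Upsilon> k))"
  unfolding fps_quot_unique[OF denominator_nth_0]
  unfolding B_series_eq[symmetric]
  using N_series_eq[of \<Upsilon> k] by (simp add: algebra_simps)

end
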